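(* Let $n$ be a positive integer and let $p:\mathbb{C}\to\mathbb{C}$ be a polynomial such that $p(s)\ge 0$ (that is, $p(s)$ is real and nonnegative) for all real $s\ge 0$ and $$|p(s)|\le s^{-1}(1+s)^n\qquad\text{for all real } s>0.$$ Then $$|p(0)|\le n^2,$$ with equality if $p=p_n$, where $p_n$ is the polynomial given by $$p_n(s)=\frac12\,\frac{(s+1)^n}{s}\left(1-T_n\!\left(\frac{1-s}{1+s}\right)\right).$$
   Context: $T_n$ denotes the $n$-th Chebyshev polynomial of the first kind, $T_n(x)=\cos(n\arccos x)$ for $x\in[-1,1]$. The expression defining $p_n(s)$ is understood as the polynomial in $s$ it defines (the singularities at $s=0$ and $s=-1$ being removable). *)

theory Defs
  imports "HOL-Analysis.Analysis"
begin

lemma poly_eqI_infinite: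
  fixes p q :: "complex poly"
  assumes "infinite A" and "\<And>x. x \<in> A \<Longrightarrow> poly p x = poly q x"
  shows "p = q"
proof (rule ccontr)
  assume "p \<noteq> q"
  hence "finite {x. poly (p - q) x = 0}"
    by (intro poly_roots_finite) simp
  moreover have "A \<subseteq> {x. poly (p - q) x = 0}"
    using assms(2) by auto
  ultimately show False
    using assms(1) finite_subset by blast
qed

text \<open>The first-kind Chebyshev polynomial, determined by its values on the real interval from
  \<open>-1\<close> to \<open>1\<close> but taken with complex coefficients so that it can be evaluated off that interval.
  Existence and uniqueness are \<open>chebyshev_T_exists\<close> and \<open>chebyshev_T_unique\<close>.\<close>

definition chebyshev_T :: "nat \<Rightarrow> complex poly" where
  "chebyshev_T n =
     (THE P. \<forall>x::real. -1 \<le> x \<and> x \<le> 1 \<longrightarrow>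
        poly P (complex_of_real x) = complex_of_real (cos (real n * arccos x)))"

lemma chebyshev_T_unique:
  assumes "\<forall>x::real. -1 \<le> x \<and> x \<le> 1 \<longrightarrow>
        poly P (complex_of_real x) = complex_of_real (cos (real n * arccos x))"
    and "\<forall>x::real. -1 \<le> x \<and> x \<le> 1 \<longrightarrow>
        poly Q (complex_of_real x) = complex_of_real (cos (real n * arccos x))"
  shows "P = Q"
proof (rule poly_eqI_infinite)
  show "infinite (complex_of_real ` {-1..1})"
    by (subst finite_image_iff) (auto intro: inj_onI)
qed (use assms in auto)

lemma chebyshev_T_exists:
  "\<exists>P. \<forall>x::real. -1 \<le> x \<and> x \<le> 1 \<longrightarrow>
        poly P (complex_of_real x) = complex_of_real (cos (real n * arccos x))"
proof (induction n rule: induct_nat_012)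
  case 0
  show ?case by (rule exI[of _ 1]) simp
next
  case 1
  show ?case by (rule exI[of _ "[:0, 1:]"]) simp
next
  case (ge2 n)
  then obtain P Q where PQ:
    "\<forall>x::real. -1 \<le> x \<and> x \<le> 1 \<longrightarrow>
        poly P (complex_of_real x) = complex_of_real (cos (real n * arccos x))"
    "\<forall>x::real. -1 \<le> x \<and> x \<le> 1 \<longrightarrow>
        poly Q (complex_of_real x) = complex_of_real (cos (real (Suc n) * arccos x))"
    by blast
  have *: "cos (real (Suc (Suc n)) * t) = 2 * cos t * cos (real (Suc n) * t) - cos (real n * t)"
    for t :: real
  proof -
    have "real (Suc (Suc n)) * t = real (Suc n) * t + t"
      "real n * t = real (Suc n) * t - t"
      by (simp_all add: algebra_simps)
    thus ?thesis by (simp only: cos_add cos_diff) (simp add: algebra_simps)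
  qed
  show ?case
    by (rule exI[of _ "[:0, 2:] * Q - P"]) (use PQ in \<open>simp add: * del: of_nat_Suc\<close>)
qed

lemma poly_chebyshev_T:
  assumes "-1 \<le> x" "x \<le> 1"
  shows "poly (chebyshev_T n) (complex_of_real x) = complex_of_real (cos (real n * arccos x))"
proof -
  have "\<exists>!P. \<forall>x::real. -1 \<le> x \<and> x \<le> 1 \<longrightarrow>
        poly P (complex_of_real x) = complex_of_real (cos (real n * arccos x))"
    using chebyshev_T_exists chebyshev_T_unique by blast
  from theI'[OF this] show ?thesis
    using assms unfolding chebyshev_T_def by blast
qed

lemma chebyshev_T_eqI:
  assumes "\<And>x::real. -1 \<le> x \<Longrightarrow> x \<le> 1 \<Longrightarrow>
        poly P (complex_of_real x) = complex_of_real (cos (real n * arccos x))"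
  shows "chebyshev_T n = P"
  using assms poly_chebyshev_T chebyshev_T_unique by blast

lemma chebyshev_T_0: "chebyshev_T 0 = 1"
  by (rule chebyshev_T_eqI) simp

lemma chebyshev_T_1: "chebyshev_T (Suc 0) = [:0, 1:]"
  by (rule chebyshev_T_eqI) simp

lemma chebyshev_T_rec:
  "chebyshev_T (Suc (Suc n)) = [:0, 2:] * chebyshev_T (Suc n) - chebyshev_T n"
proof (rule chebyshev_T_eqI)
  fix x :: real
  assume x: "-1 \<le> x" "x \<le> 1"
  define t where "t = arccos x"
  have ct: "cos t = x" using x by (simp add: t_def)
  have "real (Suc (Suc n)) * t = real (Suc n) * t + t"
    "real n * t = real (Suc n) * t - t"
    by (simp_all add: algebra_simps)
  hence "cos (real (Suc (Suc n)) * t) = 2 * cos t * cos (real (Suc n) * t) - cos (real n * t)"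
    by (simp only: cos_add cos_diff) (simp add: algebra_simps)
  thus "poly ([:0, 2:] * chebyshev_T (Suc n) - chebyshev_T n) (complex_of_real x) =
    complex_of_real (cos (real (Suc (Suc n)) * arccos x))"
    using x ct by (simp add: poly_chebyshev_T flip: t_def del: of_nat_Suc)
qed

text \<open>The polynomial is specified away from the removable singularities \<open>0\<close> and \<open>-1\<close> only, which
  also avoids the convention \<open>x / 0 = 0\<close>; \<open>poly_p_extremal\<close> shows that it is well defined.\<close>

definition p_extremal :: "nat \<Rightarrow> complex poly" where
  "p_extremal n =
     (THE P. \<forall>s. s \<noteq> 0 \<and> s \<noteq> -1 \<longrightarrow>
        poly P s = 1 / 2 * ((s + 1) ^ n / s) * (1 - poly (chebyshev_T n) ((1 - s) / (1 + s))))"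

lemma chebyshev_T_homogenized:
  "\<exists>Q. \<forall>s. s \<noteq> -1 \<longrightarrow> poly Q s = (s + 1) ^ n * poly (chebyshev_T n) ((1 - s) / (1 + s))"
proof (induction n rule: induct_nat_012)
  case 0
  show ?case by (rule exI[of _ 1]) (simp add: chebyshev_T_0)
next
  case 1
  show ?case
  proof (rule exI[of _ "[:1, -1:]"], intro allI impI)
    fix s :: complex
    assume "s \<noteq> -1"
    hence "s + 1 \<noteq> 0" by (simp add: add_eq_0_iff2)
    thus "poly [:1, -1:] s = (s + 1) ^ Suc 0 * poly (chebyshev_T (Suc 0)) ((1 - s) / (1 + s))"
      by (simp add: chebyshev_T_1 add.commute)
  qed
next
  case (ge2 n)
  then obtain P Q where PQ:
    "\<forall>s. s \<noteq> -1 \<longrightarrow> poly P s = (s + 1) ^ n * poly (chebyshev_T n) ((1 - s) / (1 + s))"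
    "\<forall>s. s \<noteq> -1 \<longrightarrow> poly Q s = (s + 1) ^ Suc n * poly (chebyshev_T (Suc n)) ((1 - s) / (1 + s))"
    by blast
  have "poly ([:2, -2:] * Q - [:1, 1:]\<^sup>2 * P) s =
        (s + 1) ^ Suc (Suc n) * poly (chebyshev_T (Suc (Suc n))) ((1 - s) / (1 + s))"
    if "s \<noteq> -1" for s
  proof -
    define a where "a = poly (chebyshev_T n) ((1 - s) / (1 + s))"
    define b where "b = poly (chebyshev_T (Suc n)) ((1 - s) / (1 + s))"
    define u where "u = s + 1"
    have u: "u \<noteq> 0" "1 + s = u" "s = u - 1"
      using that by (simp_all add: u_def add_eq_0_iff2)
    have "poly ([:2, -2:] * Q - [:1, 1:]\<^sup>2 * P) s =
          (2 - 2 * s) * (u ^ Suc n * b) - u\<^sup>2 * (u ^ n * a)"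
      using that PQ by (simp add: a_def b_def u_def algebra_simps)
    also have "\<dots> = u ^ Suc (Suc n) * (2 * ((1 - s) / u) * b - a)"
      using u(1) by (simp add: field_simps power2_eq_square)
    also have "\<dots> = (s + 1) ^ Suc (Suc n) * poly (chebyshev_T (Suc (Suc n))) ((1 - s) / (1 + s))"
      by (simp add: chebyshev_T_rec a_def b_def u_def add.commute mult.commute)
    finally show ?thesis .
  qed
  thus ?case by blast
qed

lemma poly_p_extremal:
  assumes "s \<noteq> 0" "s \<noteq> -1"
  shows "poly (p_extremal n) s =
    1 / 2 * ((s + 1) ^ n / s) * (1 - poly (chebyshev_T n) ((1 - s) / (1 + s)))"
proof -
  let ?P = "\<lambda>P. \<forall>s. s \<noteq> 0 \<and> s \<noteq> -1 \<longrightarrow> poly P s =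
    1 / 2 * ((s + 1) ^ n / s) * (1 - poly (chebyshev_T n) ((1 - s) / (1 + s)))"
  obtain Q where Q:
    "\<And>s. s \<noteq> -1 \<Longrightarrow> poly Q s = (s + 1) ^ n * poly (chebyshev_T n) ((1 - s) / (1 + s))"
    using chebyshev_T_homogenized by blast
  have "poly Q 0 = 1"
    using Q[of 0] poly_chebyshev_T[of 1 n] by simp
  hence "poly ([:1, 1:] ^ n - Q) 0 = 0" by simp
  then obtain R where R: "[:1, 1:] ^ n - Q = [:0, 1:] * R"
    using poly_eq_0_iff_dvd[of "[:1, 1:] ^ n - Q" 0] by (auto elim: dvdE)
  have "?P (smult (1 / 2) R)"
  proof (intro allI impI)
    fix s :: complex
    assume s: "s \<noteq> 0 \<and> s \<noteq> -1"
    have *: "s * poly R s = (s + 1) ^ n - poly Q s"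
      using arg_cong[OF R, of "\<lambda>p. poly p s"] by (simp add: add.commute)
    have "poly (smult (1 / 2) R) s = 1 / 2 * ((s * poly R s) / s)"
      using s by simp
    also have "\<dots> = 1 / 2 * (((s + 1) ^ n - poly Q s) / s)"
      by (simp only: *)
    finally show "poly (smult (1 / 2) R) s =
      1 / 2 * ((s + 1) ^ n / s) * (1 - poly (chebyshev_T n) ((1 - s) / (1 + s)))"
      using s Q[of s] by (simp add: right_diff_distrib diff_divide_distrib)
  qed
  moreover have "A = B" if "?P A" "?P B" for A B
  proof (rule poly_eqI_infinite)
    show "infinite (UNIV - {0, -1 :: complex})"
      using infinite_UNIV_char_0 by (intro Diff_infinite_finite) auto
  qed (use that in auto)
  ultimately have "\<exists>!P. ?P P" by blast
  from theI'[OF this] show ?thesis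
    using assms unfolding p_extremal_def by blast
qed

definition admissible :: "nat \<Rightarrow> complex poly \<Rightarrow> bool" where
  "admissible n p \<longleftrightarrow>
     (\<forall>s::real. s \<ge> 0 \<longrightarrow>
        poly p (complex_of_real s) \<in> \<real> \<and> Re (poly p (complex_of_real s)) \<ge> 0) \<and>
     (\<forall>s::real. s > 0 \<longrightarrow> cmod (poly p (complex_of_real s)) \<le> inverse s * (1 + s) ^ n)"

end

theory Submission
  imports Defs "HOL-Real_Asymp.Real_Asymp"
begin

text \<open>
  For admissible \<open>p\<close>, the quotient \<open>s p(s) / (1 + s)\<^sup>n\<close> takes values between \<open>0\<close> and \<open>1\<close> for
  positive \<open>s\<close>, while for the extremal polynomial it equals \<open>sin\<^sup>2(n\<phi>)\<close> with \<open>s = tan\<^sup>2 \<phi>\<close>. So the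
  latter attains the bounds \<open>1\<close> and \<open>0\<close> alternately at \<open>\<phi> = k\<pi>/(2n)\<close> with \<open>k = 1, \<dots>, n\<close>,
  where \<open>k = n\<close> is the point \<open>s = \<infinity>\<close>, i.e. the coefficient of \<open>s\<^bsup>n-1\<^esup>\<close>. The difference
  \<open>E = p\<^sub>n - p\<close> has degree below \<open>n\<close> and alternating signs on these \<open>n\<close> data, and interpolation
  forces \<open>E(0) \<ge> 0\<close>. The value \<open>p\<^sub>n(0) = n\<^sup>2\<close> is the limit of \<open>sin\<^sup>2(n\<phi>) / tan\<^sup>2 \<phi>\<close> at \<open>0\<close>.
\<close>

section \<open>Reduction to real polynomials, and a sign rule for interpolation\<close>

lemma Re_poly_of_real: "Re (poly p (complex_of_real x)) = poly (map_poly Re p) x"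
  by (induction p) (simp_all add: map_poly_pCons)

lemma sign_prod_diff_nonneg:
  fixes f :: "nat \<Rightarrow> real"
  assumes "\<And>i. i < m \<Longrightarrow> x < f i"
  shows "0 \<le> (-1) ^ m * (\<Prod>i<m. x - f i)"
proof -
  have "(-1) ^ m * (\<Prod>i<m. x - f i) = (\<Prod>i<m. f i - x)"
    by (induction m) (simp_all add: algebra_simps)
  moreover have "0 \<le> (\<Prod>i<m. f i - x)"
    using assms by (intro prod_nonneg) (auto intro: less_imp_le)
  ultimately show ?thesis by simp
qed

text \<open>The coefficient at \<open>m\<close> serves as a last node at infinity, so
  \<open>E\<close> is fixed by \<open>m + 1\<close> data. The induction follows Newton
  interpolation: a multiple of the polynomial vanishing at the other nodes matches the value at the
  last finite node, and the remainder is divided by its linear factor. That factor is negative to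
  the left of the node, so all signs flip and the induction hypothesis applies to minus the
  quotient.\<close>

lemma poly_nonneg_of_alternating_signs:
  fixes E :: "real poly" and s :: "nat \<Rightarrow> real"
  assumes "degree E \<le> m"
    and "\<And>i. i < m \<Longrightarrow> t < s i" and "strict_mono_on {..<m} s"
    and "\<And>i. i < m \<Longrightarrow> 0 \<le> (-1) ^ i * poly E (s i)"
    and "0 \<le> (-1) ^ m * coeff E m"
  shows "0 \<le> poly E t"
  using assms
proof (induction m arbitrary: E)
  case 0
  then obtain c where "E = [:c:]" by (metis degree_eq_zeroE le_zero_eq)
  with 0 show ?case by simp
next
  case (Suc m)
  define P where "P = (\<Prod>i<m. [:- s i, 1:])"
  have P: "poly P x = (\<Prod>i<m. x - s i)" for x
    by (simp add: P_def poly_prod)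
  have degP: "degree P = m" by (simp add: P_def degree_prod_eq_sum_degree)
  have "poly P (s m) > 0"
    unfolding P using strict_mono_onD[OF Suc.prems(3)] by (intro prod_pos) simp
  \<comment> \<open>Chosen so that \<open>E - smult a P\<close> vanishes at the last node. As
    \<open>P\<close> is positive there, \<open>a\<close> inherits the sign
    \<open>(-1) ^ m\<close>.\<close>
  define a where "a = poly E (s m) / poly P (s m)"
  have a: "0 \<le> (-1) ^ m * a"
    using Suc.prems(4)[of m] \<open>poly P (s m) > 0\<close> by (simp add: a_def)
  have "poly (E - smult a P) (s m) = 0"
    using \<open>poly P (s m) > 0\<close> by (simp add: a_def)
  then obtain F where F: "E - smult a P = [:- s m, 1:] * F"
    unfolding poly_eq_0_iff_dvd by (elim dvdE)
  have E: "poly E x = a * poly P x + (x - s m) * poly F x" for x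
    using arg_cong[OF F, of "\<lambda>p. poly p x"] by (simp add: algebra_simps)
  have degF: "degree F \<le> m"
  proof (cases "F = 0")
    case False
    have "degree ([:- s m, 1:] * F) = Suc (degree F)"
      using False by (subst degree_mult_eq) auto
    moreover have "degree (E - smult a P) \<le> Suc m"
      using Suc.prems(1) degP by (intro degree_diff_le) (auto intro: order_trans[OF degree_smult_le])
    ultimately show ?thesis using F by simp
  qed simp
  have "coeff E (Suc m) = coeff ([:- s m, 1:] * F) (Suc m)"
    unfolding F[symmetric] using degP by (simp add: coeff_eq_0)
  also have "\<dots> = coeff F m"
    using degF by (simp add: coeff_eq_0)
  finally have coeffF: "coeff E (Suc m) = coeff F m" .
  have "0 \<le> poly (- F) t"
  proof (rule Suc.IH)
    show "0 \<le> (-1) ^ i * poly (- F) (s i)" if "i < m" for i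
    proof -
      have "poly P (s i) = 0" using that by (auto simp: P)
      hence "0 \<le> (s m - s i) * ((-1) ^ i * poly (- F) (s i))"
        using Suc.prems(4)[of i] that by (simp add: E algebra_simps)
      moreover have "s m - s i > 0"
        using strict_mono_onD[OF Suc.prems(3), of i m] that by simp
      ultimately show ?thesis by (simp only: zero_le_mult_iff) linarith
    qed
    show "strict_mono_on {..<m} s"
      using Suc.prems(3) by (rule monotone_on_subset) auto
  qed (use Suc.prems degF coeffF in auto)
  hence "0 \<le> (t - s m) * poly F t"
    using Suc.prems(2)[of m] by (simp add: mult_nonpos_nonpos)
  \<comment> \<open>Since \<open>t\<close> lies left of all nodes, \<open>poly P t\<close> has the
    same sign \<open>(-1) ^ m\<close> as \<open>a\<close>.\<close>
  moreover have "0 \<le> ((-1) ^ m * a) * ((-1) ^ m * poly P t)"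
    unfolding P using a Suc.prems(2)
    by (intro mult_nonneg_nonneg[OF _ sign_prod_diff_nonneg]) auto
  hence "0 \<le> a * poly P t"
    by (cases "even m") simp_all
  ultimately show ?case by (simp add: E)
qed

section \<open>Degree and leading coefficient read off from growth at infinity\<close>

lemma poly_div_power_tendsto_coeff:
  fixes p :: "real poly"
  assumes "degree p \<le> m"
  shows "((\<lambda>x. poly p x / x ^ m) \<longlongrightarrow> coeff p m) at_top"
proof -
  have "((\<lambda>x. coeff p i * x ^ i / x ^ m) \<longlongrightarrow> (if i = m then coeff p m else 0)) at_top"
    if "i \<le> m" for i
  proof (cases "i = m")
    case True
    have "eventually (\<lambda>x. coeff p i * x ^ i / x ^ m = coeff p m) at_top"
      using eventually_gt_at_top[of "0::real"] by eventually_elim (simp add: True)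
    thus ?thesis using True by (simp add: tendsto_eventually)
  next
    case False
    have "((\<lambda>x::real. coeff p i * inverse x ^ (m - i)) \<longlongrightarrow> coeff p i * 0 ^ (m - i)) at_top"
      by (intro tendsto_intros tendsto_inverse_0_at_top filterlim_ident)
    moreover have "eventually (\<lambda>x::real. coeff p i * inverse x ^ (m - i) = coeff p i * x ^ i / x ^ m)
        at_top"
      using eventually_gt_at_top[of 0]
      by eventually_elim (use that in \<open>simp add: power_diff field_simps\<close>)
    ultimately have "((\<lambda>x. coeff p i * x ^ i / x ^ m) \<longlongrightarrow> coeff p i * 0 ^ (m - i)) at_top"
      by (rule Lim_transform_eventually)
    moreover have "m - i > 0" using False that by simp
    ultimately show ?thesis using False by (simp add: power_0_left)
  qed
  hence "((\<lambda>x. \<Sum>i\<le>m. coeff p i * x ^ i / x ^ m) \<longlongrightarrow> (\<Sum>i\<le>m. if i = m then coeff p m else 0)) at_top"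
    by (intro tendsto_sum) auto
  moreover have "poly p x = (\<Sum>i\<le>m. coeff p i * x ^ i)" for x
    unfolding poly_altdef using assms by (intro sum.mono_neutral_left) (auto simp: coeff_eq_0)
  ultimately show ?thesis
    by (simp add: sum_divide_distrib)
qed

text \<open>If the degree exceeded \<open>n\<close>, dividing by \<open>x ^ degree p\<close> would
  give the limit 0, whereas this limit is the leading coefficient.\<close>

lemma degree_le_of_bound:
  fixes p :: "real poly"
  assumes "\<And>x. x > 0 \<Longrightarrow> \<bar>poly p x\<bar> \<le> (1 + x) ^ n"
  shows "degree p \<le> n"
proof (rule ccontr)
  assume *: "\<not> degree p \<le> n"
  have "((\<lambda>x. poly p x / x ^ degree p) \<longlongrightarrow> 0) at_top"
  proof (rule Lim_null_comparison)
    show "eventually (\<lambda>x. norm (poly p x / x ^ degree p) \<le> (1 + inverse x) ^ n * inverse x) at_top"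
      using eventually_ge_at_top[of 1]
    proof eventually_elim
      case (elim x)
      have "norm (poly p x / x ^ degree p) \<le> (1 + x) ^ n / x ^ degree p"
        using assms[of x] elim by (simp add: divide_right_mono)
      also have "\<dots> \<le> (1 + x) ^ n / x ^ Suc n"
        using elim * by (intro divide_left_mono power_increasing mult_pos_pos) auto
      also have "\<dots> = ((1 + x) / x) ^ n * inverse x"
        by (simp add: power_divide field_simps)
      also have "(1 + x) / x = 1 + inverse x"
        using elim by (simp add: field_simps)
      finally show ?case .
    qed
    have "((\<lambda>x::real. (1 + inverse x) ^ n * inverse x) \<longlongrightarrow> (1 + 0) ^ n * 0) at_top"
      by (intro tendsto_intros tendsto_inverse_0_at_top filterlim_ident)
    thus "((\<lambda>x::real. (1 + inverse x) ^ n * inverse x) \<longlongrightarrow> 0) at_top" by simp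
  qed
  from tendsto_unique[OF _ this poly_div_power_tendsto_coeff[OF order_refl]]
  have "lead_coeff p = 0" by simp
  with * show False by simp
qed

text \<open>The bound concerns \<open>pCons 0 r\<close>, whose coefficient at \<open>n\<close> is
  that of \<open>r\<close> at \<open>n - 1\<close>. The limit later transfers bounds at finite
  \<open>x\<close> to the node at infinity.\<close>

lemma degree_and_leading_limit_of_bound:
  fixes r :: "real poly"
  assumes n: "n > 0"
    and r: "\<And>x. x > 0 \<Longrightarrow> 0 \<le> x * poly r x \<and> x * poly r x \<le> (1 + x) ^ n"
  shows "degree r \<le> n - 1"
    and "((\<lambda>x. x * poly r x / (1 + x) ^ n) \<longlongrightarrow> coeff r (n - 1)) at_top"
proof -
  have deg: "degree (pCons 0 r) \<le> n"
    using r by (intro degree_le_of_bound) simp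
  thus "degree r \<le> n - 1"
    using n by (cases "r = 0") auto
  have "((\<lambda>x::real. x / (1 + x)) \<longlongrightarrow> 1) at_top"
    by real_asymp
  hence "((\<lambda>x. poly (pCons 0 r) x / x ^ n * (x / (1 + x)) ^ n) \<longlongrightarrow> coeff (pCons 0 r) n * 1 ^ n) at_top"
    by (intro tendsto_intros poly_div_power_tendsto_coeff deg)
  moreover have "eventually (\<lambda>x. poly (pCons 0 r) x / x ^ n * (x / (1 + x)) ^ n =
      x * poly r x / (1 + x) ^ n) at_top"
    using eventually_gt_at_top[of 0] by eventually_elim (simp add: power_divide)
  ultimately show "((\<lambda>x. x * poly r x / (1 + x) ^ n) \<longlongrightarrow> coeff r (n - 1)) at_top"
    using n by (cases n) (simp_all add: Lim_transform_eventually)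
qed

section \<open>Values of the extremal polynomial\<close>

lemma poly_p_extremal_of_real:
  assumes "x > 0"
  shows "poly (p_extremal n) (complex_of_real x) =
    complex_of_real ((1 + x) ^ n / x * ((1 - cos (real n * arccos ((1 - x) / (1 + x)))) / 2))"
proof -
  have y: "(1 - complex_of_real x) / (1 + complex_of_real x) = complex_of_real ((1 - x) / (1 + x))"
    by simp
  have "complex_of_real x \<noteq> -1"
    using assms by (metis of_real_1 of_real_minus of_real_eq_iff not_one_less_zero neg_0_less_iff_less)
  have "-1 \<le> (1 - x) / (1 + x)" "(1 - x) / (1 + x) \<le> 1"
    using assms by (simp_all add: field_simps)
  hence T: "poly (chebyshev_T n) ((1 - complex_of_real x) / (1 + complex_of_real x)) =
      complex_of_real (cos (real n * arccos ((1 - x) / (1 + x))))"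
    unfolding y by (rule poly_chebyshev_T)
  have "poly (p_extremal n) (complex_of_real x) =
      1 / 2 * ((complex_of_real x + 1) ^ n / complex_of_real x) *
      (1 - complex_of_real (cos (real n * arccos ((1 - x) / (1 + x)))))"
    using assms \<open>complex_of_real x \<noteq> -1\<close> by (subst poly_p_extremal) (simp_all only: T, simp_all)
  thus ?thesis
    by (simp add: add.commute)
qed

text \<open>With \<open>s = (tan t)\<^sup>2\<close> the argument \<open>(1 - s) / (1 + s)\<close> is
  \<open>cos (2 * t)\<close>, and \<open>2 * t\<close> lies in the range of \<open>arccos\<close>;
  the half-angle formula then produces the squared sine.\<close>

lemma poly_p_extremal_tan:
  assumes "0 < t" "t < pi / 2"
  shows "(tan t)\<^sup>2 * poly (map_poly Re (p_extremal n)) ((tan t)\<^sup>2) =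
    (1 + (tan t)\<^sup>2) ^ n * (sin (real n * t))\<^sup>2"
proof -
  have "cos t > 0" using assms by (intro cos_gt_zero) auto
  have "tan t > 0" using assms by (intro tan_gt_zero) auto
  have "(1 - (tan t)\<^sup>2) / (1 + (tan t)\<^sup>2) = cos (2 * t)"
  proof -
    have "(tan t)\<^sup>2 * (cos t)\<^sup>2 = (sin t)\<^sup>2"
      using \<open>cos t > 0\<close> by (simp add: tan_def flip: power_mult_distrib)
    hence "(1 - (tan t)\<^sup>2) * (cos t)\<^sup>2 = cos (2 * t)" "(1 + (tan t)\<^sup>2) * (cos t)\<^sup>2 = 1"
      by (simp_all add: cos_double left_diff_distrib distrib_right)
    moreover have "(1 - (tan t)\<^sup>2) / (1 + (tan t)\<^sup>2) =
        ((1 - (tan t)\<^sup>2) * (cos t)\<^sup>2) / ((1 + (tan t)\<^sup>2) * (cos t)\<^sup>2)"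
      using \<open>cos t > 0\<close> by simp
    ultimately show ?thesis by simp
  qed
  hence "arccos ((1 - (tan t)\<^sup>2) / (1 + (tan t)\<^sup>2)) = 2 * t"
    using assms by (simp add: arccos_cos)
  moreover have "(1 - cos (real n * (2 * t))) / 2 = (sin (real n * t))\<^sup>2"
    using cos_double_sin[of "real n * t"] by (simp add: mult_ac)
  ultimately show ?thesis
    using \<open>tan t > 0\<close> poly_p_extremal_of_real[of "(tan t)\<^sup>2" n]
    by (simp flip: Re_poly_of_real del: of_real_power)
qed

text \<open>The defining formula says nothing at 0, so the value comes from continuity along
  \<open>(tan t)\<^sup>2\<close> as \<open>t\<close> decreases to 0.\<close>

lemma poly_p_extremal_0: "poly (map_poly Re (p_extremal n)) 0 = (real n)\<^sup>2"
proof (rule tendsto_unique[of "at_right (0::real)"])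
  let ?q = "map_poly Re (p_extremal n)"
  have "((\<lambda>t. (tan t)\<^sup>2) \<longlongrightarrow> (tan (0::real))\<^sup>2) (at_right 0)"
    by (intro tendsto_intros) auto
  thus "((\<lambda>t. poly ?q ((tan t)\<^sup>2)) \<longlongrightarrow> poly ?q 0) (at_right 0)"
    by (intro tendsto_intros) simp
  have "((\<lambda>t. sin (real n * t) / tan t) \<longlongrightarrow> real n) (at_right 0)"
    by real_asymp
  hence "((\<lambda>t. (1 + (tan t)\<^sup>2) ^ n * (sin (real n * t) / tan t)\<^sup>2) \<longlongrightarrow>
      (1 + (tan 0)\<^sup>2) ^ n * (real n)\<^sup>2) (at_right 0)"
    by (intro tendsto_intros) auto
  moreover have "eventually (\<lambda>t. (1 + (tan t)\<^sup>2) ^ n * (sin (real n * t) / tan t)\<^sup>2 =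
      poly ?q ((tan t)\<^sup>2)) (at_right 0)"
    using eventually_at_right_real[OF pi_half_gt_zero]
  proof eventually_elim
    case (elim t)
    hence t: "0 < t" "t < pi / 2" by auto
    hence "tan t > 0" by (intro tan_gt_zero)
    with poly_p_extremal_tan[OF t, of n] show ?case
      by (simp add: power_divide field_simps)
  qed
  ultimately show "((\<lambda>t. poly ?q ((tan t)\<^sup>2)) \<longlongrightarrow> (real n)\<^sup>2) (at_right 0)"
    by (simp add: Lim_transform_eventually)
qed simp

text \<open>\<open>map_poly Re\<close> controls only the real part; the imaginary part vanishes on
  the positive reals and hence, by continuity, at 0.\<close>

lemma Im_poly_p_extremal_0: "Im (poly (p_extremal n) 0) = 0"
proof (rule tendsto_unique[of "at_right (0::real)"])
  have "((\<lambda>x. Im (poly (p_extremal n) (complex_of_real x))) \<longlongrightarrow>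
      Im (poly (p_extremal n) (complex_of_real 0))) (at_right 0)"
    by (intro tendsto_intros)
  thus "((\<lambda>x. Im (poly (p_extremal n) (complex_of_real x))) \<longlongrightarrow> Im (poly (p_extremal n) 0)) (at_right 0)"
    by simp
  have "eventually (\<lambda>x. Im (poly (p_extremal n) (complex_of_real x)) = 0) (at_right 0)"
    using eventually_at_right_less[of 0]
    by eventually_elim (simp only: poly_p_extremal_of_real Im_complex_of_real)
  thus "((\<lambda>x. Im (poly (p_extremal n) (complex_of_real x))) \<longlongrightarrow> 0) (at_right 0)"
    by (rule tendsto_eventually)
qed simp

lemma poly_p_extremal_0_complex: "poly (p_extremal n) 0 = complex_of_real ((real n)\<^sup>2)"
  using poly_p_extremal_0[of n] Im_poly_p_extremal_0[of n] Re_poly_of_real[of "p_extremal n" 0]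
  by (simp add: complex_eq_iff)

lemma admissible_p_extremal: "admissible n (p_extremal n)"
  unfolding admissible_def
proof (intro conjI allI impI)
  fix x :: real
  \<comment> \<open>For \<open>x > 0\<close> this is the fraction of the permitted bound that is
    attained, so \<open>0 \<le> c \<le> 1\<close> gives both conditions; \<open>x = 0\<close> uses
    the known value there.\<close>
  define c where "c = (1 - cos (real n * arccos ((1 - x) / (1 + x)))) / 2"
  have c: "0 \<le> c" "c \<le> 1"
    using cos_ge_minus_one[of "real n * arccos ((1 - x) / (1 + x))"] by (simp_all add: c_def)
  have p: "poly (p_extremal n) (complex_of_real x) = complex_of_real ((1 + x) ^ n / x * c)" if "x > 0"
    using poly_p_extremal_of_real[OF that] by (simp only: c_def)
  show "poly (p_extremal n) (complex_of_real x) \<in> \<real>" if "x \<ge> 0"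
    using p poly_p_extremal_0_complex[of n] that by (cases "x = 0") (auto simp del: of_real_power)
  show "0 \<le> Re (poly (p_extremal n) (complex_of_real x))" if "x \<ge> 0"
    using p c poly_p_extremal_0_complex[of n] that
    by (cases "x = 0") (simp_all del: of_real_power of_real_mult of_real_divide)
  show "cmod (poly (p_extremal n) (complex_of_real x)) \<le> inverse x * (1 + x) ^ n" if "x > 0"
    using p c that mult_left_mono[OF c(2), of "(1 + x) ^ n / x"]
    by (simp del: of_real_power of_real_mult of_real_divide add: abs_mult field_simps)
qed

section \<open>Comparison at the nodes, including the one at infinity\<close>

lemma admissible_bounds:
  assumes "admissible n p" "x > 0"
  shows "0 \<le> x * poly (map_poly Re p) x \<and> x * poly (map_poly Re p) x \<le> (1 + x) ^ n"
proof -
  have "0 \<le> poly (map_poly Re p) x" "poly (map_poly Re p) x \<le> inverse x * (1 + x) ^ n"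
    using assms complex_Re_le_cmod[of "poly p (complex_of_real x)"]
    unfolding admissible_def by (auto simp flip: Re_poly_of_real intro: order_trans)
  thus ?thesis
    using assms(2) by (simp add: field_simps)
qed

text \<open>As \<open>x\<close> grows, \<open>(1 - x) / (1 + x)\<close> tends to -1, where the
  Chebyshev polynomial equals \<open>(-1) ^ n\<close>. This is the datum at the node at
  infinity.\<close>

lemma coeff_p_extremal:
  assumes "n > 0"
  shows "coeff (map_poly Re (p_extremal n)) (n - 1) = (1 - (-1) ^ n) / 2"
proof (rule tendsto_unique[of "at_top :: real filter"])
  let ?q = "map_poly Re (p_extremal n)" and ?T = "map_poly Re (chebyshev_T n)"
  show "((\<lambda>x. x * poly ?q x / (1 + x) ^ n) \<longlongrightarrow> coeff ?q (n - 1)) at_top"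
    by (rule degree_and_leading_limit_of_bound[OF assms admissible_bounds[OF admissible_p_extremal]])
  have T: "poly ?T y = cos (real n * arccos y)" if "-1 \<le> y" "y \<le> 1" for y
    using poly_chebyshev_T[OF that, of n] by (simp flip: Re_poly_of_real)
  have "((\<lambda>x::real. (1 - x) / (1 + x)) \<longlongrightarrow> -1) at_top"
    by real_asymp
  hence "((\<lambda>x. (1 - poly ?T ((1 - x) / (1 + x))) / 2) \<longlongrightarrow> (1 - poly ?T (-1)) / 2) at_top"
    by (intro tendsto_intros) auto
  moreover have "poly ?T (-1) = (-1) ^ n"
    using T[of "-1"] by simp
  moreover have "eventually (\<lambda>x. (1 - poly ?T ((1 - x) / (1 + x))) / 2 =
      x * poly ?q x / (1 + x) ^ n) at_top"
    using eventually_gt_at_top[of 0]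
  proof eventually_elim
    case (elim x)
    hence "poly ?T ((1 - x) / (1 + x)) = cos (real n * arccos ((1 - x) / (1 + x)))"
      by (intro T) (simp_all add: field_simps)
    thus ?case
      using elim poly_p_extremal_of_real[OF elim, of n]
      by (simp flip: Re_poly_of_real del: of_real_power of_real_mult of_real_divide)
  qed
  ultimately show "((\<lambda>x. x * poly ?q x / (1 + x) ^ n) \<longlongrightarrow> (1 - (-1) ^ n) / 2) at_top"
    by (simp add: Lim_transform_eventually)
qed simp

lemma sin_multiple_pi_half_squared: "(sin (real k * (pi / 2)))\<^sup>2 = (if odd k then 1 else 0)"
proof -
  have "(sin (real k * (pi / 2)))\<^sup>2 = (1 - cos (real k * pi)) / 2"
    using cos_double_sin[of "real k * (pi / 2)"] by simp
  thus ?thesis by (cases "even k") simp_all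
qed

lemma admissible_le_p_extremal_0:
  assumes n: "n > 0" and p: "admissible n p"
  shows "poly (map_poly Re p) 0 \<le> (real n)\<^sup>2"
proof -
  define q where "q = map_poly Re (p_extremal n)"
  define r where "r = map_poly Re p"
  \<comment> \<open>Indices start at 0, so \<open>t i\<close> is the angle with
    \<open>k = i + 1\<close>. The index \<open>n - 1\<close> would give \<open>pi / 2\<close>, where
    the node is infinite; hence only \<open>i < n - 1\<close> are finite nodes.\<close>
  define t where "t i = real (Suc i) / real n * (pi / 2)" for i
  define s where "s i = (tan (t i))\<^sup>2" for i
  note rb = admissible_bounds[OF p, folded r_def]
  note qb = admissible_bounds[OF admissible_p_extremal, of _ n, folded q_def]
  have t: "0 < t i" "t i < pi / 2" if "i < n - 1" for i
  proof -
    show "0 < t i" using n by (simp add: t_def)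
    have "real (Suc i) / real n < 1" using that by (simp add: field_simps)
    from mult_strict_right_mono[OF this pi_half_gt_zero] show "t i < pi / 2"
      by (simp add: t_def)
  qed
  have s_pos: "s i > 0" if "i < n - 1" for i
    using tan_gt_zero[OF t[OF that]] by (simp add: s_def)
  have "0 \<le> poly (q - r) 0"
  proof (rule poly_nonneg_of_alternating_signs)
    show "degree (q - r) \<le> n - 1"
      using degree_and_leading_limit_of_bound(1)[OF n rb] degree_and_leading_limit_of_bound(1)[OF n qb]
      by (intro degree_diff_le)
    show "0 < s i" if "i < n - 1" for i
      by (rule s_pos[OF that])
    show "strict_mono_on {..<n - 1} s"
    proof (rule strict_mono_onI)
      fix i j assume ij: "i \<in> {..<n - 1}" "j \<in> {..<n - 1}" "i < j"
      have "t i < t j"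
        using ij n by (simp add: t_def field_simps)
      hence "tan (t i) < tan (t j)"
        using t[of i] t[of j] ij by (intro tan_monotone) auto
      thus "s i < s j"
        using tan_gt_zero[of "t i"] t[of i] ij by (simp add: s_def power_strict_mono)
    qed
    show "0 \<le> (-1) ^ i * poly (q - r) (s i)" if i: "i < n - 1" for i
    proof -
      have "real n * t i = real (Suc i) * (pi / 2)"
        using n by (simp add: t_def)
      \<comment> \<open>Because \<open>k = i + 1\<close>, the upper bound is attained at even
        \<open>i\<close> and 0 at odd \<open>i\<close>; the bounds on \<open>r\<close> then give
        \<open>q - r\<close> the sign \<open>(-1) ^ i\<close>.\<close>
      hence sq: "s i * poly q (s i) = (1 + s i) ^ n * (if even i then 1 else 0)"
        using poly_p_extremal_tan[OF t[OF i], of n] sin_multiple_pi_half_squared[of "Suc i"]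
        by (simp only: s_def q_def even_Suc not_not)
      have "0 \<le> (-1) ^ i * (s i * poly q (s i) - s i * poly r (s i))"
        unfolding sq using rb[OF s_pos[OF i]] by (cases "even i") simp_all
      hence "0 \<le> s i * ((-1) ^ i * poly (q - r) (s i))"
        by (simp add: algebra_simps)
      thus ?thesis
        using s_pos[OF i] by (simp add: zero_le_mult_iff)
    qed
    \<comment> \<open>At infinity the coefficient of \<open>r\<close> is squeezed between 0 and 1,
      while that of \<open>q\<close> is 1 for odd \<open>n\<close> and 0 for even \<open>n\<close>,
      which continues the alternation.\<close>
    have lim: "((\<lambda>x. x * poly r x / (1 + x) ^ n) \<longlongrightarrow> coeff r (n - 1)) at_top"
      by (rule degree_and_leading_limit_of_bound(2)[OF n rb])
    have ev: "eventually (\<lambda>x. 0 \<le> x * poly r x / (1 + x) ^ n \<and> x * poly r x / (1 + x) ^ n \<le> 1) at_top"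
      using eventually_gt_at_top[of 0] by eventually_elim (use rb in simp)
    have "0 \<le> coeff r (n - 1)"
      by (rule tendsto_lowerbound[OF lim]) (use ev in \<open>auto elim: eventually_mono\<close>)
    moreover have "coeff r (n - 1) \<le> 1"
      by (rule tendsto_upperbound[OF lim]) (use ev in \<open>auto elim: eventually_mono\<close>)
    ultimately show "0 \<le> (-1) ^ (n - 1) * coeff (q - r) (n - 1)"
      using coeff_p_extremal[OF n] n by (cases n; cases "even n") (simp_all add: q_def)
  qed
  thus ?thesis
    by (simp add: q_def r_def poly_p_extremal_0)
qed

theorem lemma1p1:
  fixes n :: nat
  assumes "n > 0"
  shows "(\<forall>p. admissible n p \<longrightarrow> cmod (poly p 0) \<le> (real n)\<^sup>2) \<and>
         admissible n (p_extremal n) \<and>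
         cmod (poly (p_extremal n) 0) = (real n)\<^sup>2"
proof (intro conjI allI impI)
  fix p assume p: "admissible n p"
  \<comment> \<open>Admissibility covers \<open>s = 0\<close>, so the modulus of the value there is
    its real part.\<close>
  hence "poly p 0 \<in> \<real>" "0 \<le> Re (poly p 0)"
    unfolding admissible_def by (metis of_real_0 order_refl)+
  hence "cmod (poly p 0) = Re (poly p 0)"
    by (auto elim!: Reals_cases)
  thus "cmod (poly p 0) \<le> (real n)\<^sup>2"
    using admissible_le_p_extremal_0[OF assms p] Re_poly_of_real[of p 0] by simp
qed (simp_all add: admissible_p_extremal poly_p_extremal_0_complex norm_power)

end
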